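(* Let $a,b\in\mathbb{H}_s\setminus\mathbb{R}$ with $a_0=b_0$ and $K(a)=K(b)$. Then the general solution $x\in\mathbb{H}_s$ of the linear equation $xa=bx$ is $$x=y-\frac{yaa'-bya'-b'ya+b'by}{2(|\Im(a)|^2+|\Im(b)|^2)},\qquad y\in\mathbb{H}_s\text{ arbitrary}.$$
   Context: $\mathbb{H}_s=\{q_0+q_1\mathbf{i}+q_2\mathbf{j}+q_3\mathbf{k}: q_i\in\mathbb{R}\}$ is the real associative algebra of split quaternions with $\mathbf{i}^2=-1$, $\mathbf{j}^2=\mathbf{k}^2=1$, $\mathbf{i}\mathbf{j}=\mathbf{k}=-\mathbf{j}\mathbf{i}$, $\mathbf{j}\mathbf{k}=-\mathbf{i}=-\mathbf{k}\mathbf{j}$, $\mathbf{k}\mathbf{i}=\mathbf{j}=-\mathbf{i}\mathbf{k}$. For $q=q_0+q_1\mathbf{i}+q_2\mathbf{j}+q_3\mathbf{k}$: $\Im(q)=q_1\mathbf{i}+q_2\mathbf{j}+q_3\mathbf{k}$; $K(q)=\Im(q)^2=-q_1^2+q_2^2+q_3^2$; $q'=q_0-q_1\mathbf{i}+q_2\mathbf{j}+q_3\mathbf{k}$; $|\Im(q)|^2=q_1^2+q_2^2+q_3^2$. $a_0,b_0$ denote the real parts (coefficients of $1$) of $a,b$. *)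

theory Defs
  imports Complex_Main
begin

datatype split_quat =
  SQuat (sq0: real) (sq1: real) (sq2: real) (sq3: real)

lemma split_quat_eq_iff:
  "p = q \<longleftrightarrow> sq0 p = sq0 q \<and> sq1 p = sq1 q \<and> sq2 p = sq2 q \<and> sq3 p = sq3 q"
  by (cases p; cases q) simp

instantiation split_quat :: real_algebra_1
begin

definition zero_split_quat :: split_quat where
  "0 = SQuat 0 0 0 0"

definition one_split_quat :: split_quat where
  "1 = SQuat 1 0 0 0"

definition plus_split_quat :: "split_quat \<Rightarrow> split_quat \<Rightarrow> split_quat" where
  "p + q = SQuat (sq0 p + sq0 q) (sq1 p + sq1 q) (sq2 p + sq2 q) (sq3 p + sq3 q)"

definition uminus_split_quat :: "split_quat \<Rightarrow> split_quat" where
  "- q = SQuat (- sq0 q) (- sq1 q) (- sq2 q) (- sq3 q)"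

definition minus_split_quat :: "split_quat \<Rightarrow> split_quat \<Rightarrow> split_quat" where
  "p - q = SQuat (sq0 p - sq0 q) (sq1 p - sq1 q) (sq2 p - sq2 q) (sq3 p - sq3 q)"

definition scaleR_split_quat :: "real \<Rightarrow> split_quat \<Rightarrow> split_quat" where
  "scaleR r q = SQuat (r * sq0 q) (r * sq1 q) (r * sq2 q) (r * sq3 q)"

text \<open>The bilinear extension of the multiplication table of the basis
  \<open>1, i, j, k\<close>, which is recovered in \<open>split_quat_units\<close> below.\<close>

definition times_split_quat :: "split_quat \<Rightarrow> split_quat \<Rightarrow> split_quat" where
  "p * q = SQuat
     (sq0 p * sq0 q - sq1 p * sq1 q + sq2 p * sq2 q + sq3 p * sq3 q)
     (sq0 p * sq1 q + sq1 p * sq0 q - sq2 p * sq3 q + sq3 p * sq2 q)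
     (sq0 p * sq2 q - sq1 p * sq3 q + sq2 p * sq0 q + sq3 p * sq1 q)
     (sq0 p * sq3 q + sq1 p * sq2 q - sq2 p * sq1 q + sq3 p * sq0 q)"

instance
  by standard
    (simp_all add: split_quat_eq_iff zero_split_quat_def one_split_quat_def
      plus_split_quat_def uminus_split_quat_def minus_split_quat_def
      scaleR_split_quat_def times_split_quat_def algebra_simps)

end

definition sq_i :: split_quat where "sq_i = SQuat 0 1 0 0"
definition sq_j :: split_quat where "sq_j = SQuat 0 0 1 0"
definition sq_k :: split_quat where "sq_k = SQuat 0 0 0 1"

lemma split_quat_units:
  "sq_i * sq_i = - 1" "sq_j * sq_j = 1" "sq_k * sq_k = 1"
  "sq_i * sq_j = sq_k" "sq_j * sq_i = - sq_k"
  "sq_j * sq_k = - sq_i" "sq_k * sq_j = sq_i"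
  "sq_k * sq_i = sq_j" "sq_i * sq_k = - sq_j"
  by (simp_all add: sq_i_def sq_j_def sq_k_def times_split_quat_def
      one_split_quat_def uminus_split_quat_def)

lemma of_real_split_quat: "of_real r = SQuat r 0 0 0"
  by (simp add: of_real_def scaleR_split_quat_def one_split_quat_def)

lemma split_quat_expand:
  "q = of_real (sq0 q) + sq1 q *\<^sub>R sq_i + sq2 q *\<^sub>R sq_j + sq3 q *\<^sub>R sq_k"
  by (simp add: split_quat_eq_iff of_real_split_quat scaleR_split_quat_def
      plus_split_quat_def sq_i_def sq_j_def sq_k_def)

definition sq_Im :: "split_quat \<Rightarrow> split_quat" where
  "sq_Im q = SQuat 0 (sq1 q) (sq2 q) (sq3 q)"

definition sq_K :: "split_quat \<Rightarrow> real" where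
  "sq_K q = - (sq1 q)\<^sup>2 + (sq2 q)\<^sup>2 + (sq3 q)\<^sup>2"

lemma sq_Im_power2: "(sq_Im q)\<^sup>2 = of_real (sq_K q)"
  by (simp add: sq_Im_def sq_K_def of_real_split_quat power2_eq_square times_split_quat_def)

text \<open>The involution \<open>q'\<close>: only the coefficient of \<open>i\<close> changes sign, so this is not
  the usual conjugation.\<close>

definition sq_prime :: "split_quat \<Rightarrow> split_quat" where
  "sq_prime q = SQuat (sq0 q) (- sq1 q) (sq2 q) (sq3 q)"

text \<open>The squared Euclidean length of the imaginary part, written
  \<open>|Im q|\<^sup>2\<close>; unlike \<^const>\<open>sq_K\<close> it is positive definite on imaginary parts.\<close>

definition sq_Im_norm2 :: "split_quat \<Rightarrow> real" where
  "sq_Im_norm2 q = (sq1 q)\<^sup>2 + (sq2 q)\<^sup>2 + (sq3 q)\<^sup>2"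

end

theory Submission
  imports Defs
begin

text \<open>
  The formula is an orthogonal projection in disguise. Consider the linear map
  \<open>T y = y a - b y\<close>, whose kernel is the solution set. The algebra is isomorphic to that of
  the real \<open>2 \<times> 2\<close> matrices, with \<open>i\<close> antisymmetric and \<open>j\<close>, \<open>k\<close> symmetric, so \<open>q'\<close> is the
  transpose of \<open>q\<close>, and \<open>T* y = y a' - b' y\<close> is the adjoint of \<open>T\<close> for the Euclidean inner
  product. The numerator of the formula is \<open>T* (T y)\<close>. With \<open>N\<close> the denominator, the claim
  is therefore that \<open>I - T* T / N\<close> maps onto the kernel of \<open>T\<close>.

  Equal real parts of \<open>a\<close> and \<open>b\<close> cancel in \<open>T\<close>, and likewise in \<open>T*\<close>, so \<open>a\<close> and \<open>b\<close> may be
  replaced by their imaginary parts, which then square to the same real number. Put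
  \<open>S y = y a + b y\<close> with adjoint \<open>S* y = y a' + b' y\<close>. The proof rests on two identities:
  \<open>T S = 0\<close>, because \<open>T (S y) = y a\<^sup>2 - b\<^sup>2 y\<close> and the two equal squares are real
  (\<open>sylvester_sylvester_minus_eq_0\<close>); and \<open>T* T + S S* = N I\<close>, because the mixed terms cancel
  and \<open>q q' + q' q = 2 |q|\<^sup>2\<close> for imaginary \<open>q\<close> (\<open>sylvester_Laplacian\<close>). They give
  \<open>T (y - T* T y / N) = T S S* y / N = 0\<close>, so every element of the stated form is a solution.
  Conversely, a solution \<open>x\<close> has \<open>T x = 0\<close> and is obtained from the choice \<open>y = x\<close>. As
  \<open>a\<close> is not real, \<open>N\<close> is positive.
\<close>

text \<open>Since \<open>S\<close> is \<open>T\<close> with \<open>b\<close> negated, and \<open>T*\<close>, \<open>S*\<close> arise by priming the coefficients,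
  all four operators are instances of this one.\<close>

definition sylvester :: "'a::ring \<Rightarrow> 'a \<Rightarrow> 'a \<Rightarrow> 'a" where
  "sylvester a b y = y * a - b * y"

lemma sylvester_eq_0_iff: "sylvester a b x = 0 \<longleftrightarrow> x * a = b * x"
  by (simp add: sylvester_def)

lemma sylvester_scaleR:
  fixes a b y :: "'a::real_algebra"
  shows "sylvester a b (r *\<^sub>R y) = r *\<^sub>R sylvester a b y"
  by (simp add: sylvester_def scaleR_diff_right)

lemma sylvester_add_of_real:
  fixes a b y :: "'a::real_algebra_1"
  shows "sylvester (of_real r + a) (of_real r + b) y = sylvester a b y"
  by (simp add: sylvester_def of_real_def algebra_simps)

text \<open>The expression expands to \<open>y a\<^sup>2 - b\<^sup>2 y\<close>, and real numbers are central.\<close>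

lemma sylvester_sylvester_minus_eq_0:
  fixes a b y :: "'a::real_algebra_1"
  assumes "a\<^sup>2 = of_real r" and "b\<^sup>2 = of_real r"
  shows "sylvester a b (sylvester a (- b) y) = 0"
proof -
  have "sylvester a b (sylvester a (- b) y) = y * a\<^sup>2 - b\<^sup>2 * y"
    by (simp add: sylvester_def power2_eq_square algebra_simps)
  also have "\<dots> = 0"
    by (simp add: assms of_real_def)
  finally show ?thesis .
qed

lemma split_quat_eq_Re_plus_Im: "q = of_real (sq0 q) + sq_Im q"
  by (simp add: split_quat_eq_iff of_real_split_quat plus_split_quat_def sq_Im_def)

lemma sq_prime_eq_Re_plus_Im: "sq_prime q = of_real (sq0 q) + sq_prime (sq_Im q)"
  by (simp add: split_quat_eq_iff of_real_split_quat plus_split_quat_def sq_Im_def sq_prime_def)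

lemma sylvester_sq_Im:
  assumes "sq0 a = sq0 b"
  shows "sylvester a b y = sylvester (sq_Im a) (sq_Im b) y"
  by (metis assms split_quat_eq_Re_plus_Im sylvester_add_of_real)

lemma sylvester_sq_prime_sq_Im:
  assumes "sq0 a = sq0 b"
  shows "sylvester (sq_prime a) (sq_prime b) y
    = sylvester (sq_prime (sq_Im a)) (sq_prime (sq_Im b)) y"
  by (metis assms sq_prime_eq_Re_plus_Im sylvester_add_of_real)

text \<open>For a traceless \<open>2 \<times> 2\<close> matrix \<open>M\<close>, the sum \<open>M M\<^sup>T + M\<^sup>T M\<close> is a multiple of the identity;
  this is that fact in split quaternions. The sum of both orders is thus central, which in
  general neither product is by itself.\<close>

lemma sq_Im_mult_sq_prime_symmetrized:
  "sq_Im q * sq_prime (sq_Im q) + sq_prime (sq_Im q) * sq_Im q = of_real (2 * sq_Im_norm2 q)"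
  by (simp add: split_quat_eq_iff of_real_split_quat plus_split_quat_def times_split_quat_def
      sq_Im_def sq_prime_def sq_Im_norm2_def power2_eq_square)

text \<open>The identity \<open>T* T + S S* = N I\<close>. The mixed terms \<open>b y a'\<close> and \<open>b' y a\<close> occur in the
  two summands with opposite signs, and the symmetrized products of the coefficients remain.\<close>

lemma sylvester_Laplacian:
  fixes a b y :: split_quat
  defines "p \<equiv> sq_Im a" and "q \<equiv> sq_Im b"
  shows "sylvester (sq_prime p) (sq_prime q) (sylvester p q y)
      + sylvester p (- q) (sylvester (sq_prime p) (- sq_prime q) y)
    = (2 * (sq_Im_norm2 a + sq_Im_norm2 b)) *\<^sub>R y"
proof -
  have "sylvester (sq_prime p) (sq_prime q) (sylvester p q y)
      + sylvester p (- q) (sylvester (sq_prime p) (- sq_prime q) y)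
    = y * (p * sq_prime p + sq_prime p * p) + (q * sq_prime q + sq_prime q * q) * y"
    by (simp add: sylvester_def algebra_simps)
  also have "\<dots> = (2 * (sq_Im_norm2 a + sq_Im_norm2 b)) *\<^sub>R y"
    unfolding p_def q_def sq_Im_mult_sq_prime_symmetrized
    by (simp add: of_real_def scaleR_add_left distrib_left)
  finally show ?thesis .
qed

lemma sq_Im_norm2_pos:
  assumes "q \<notin> \<real>"
  shows "sq_Im_norm2 q > 0"
proof (rule ccontr)
  assume "\<not> sq_Im_norm2 q > 0"
  then have "sq1 q = 0 \<and> sq2 q = 0 \<and> sq3 q = 0"
    unfolding sq_Im_norm2_def
    by (smt (verit) zero_le_power2 zero_less_power2)
  then have "q = of_real (sq0 q)"
    by (simp add: split_quat_eq_iff of_real_split_quat)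
  then show False
    using assms by (metis Reals_of_real)
qed

theorem theorem4p1:
  fixes a b :: split_quat
  assumes "a \<notin> \<real>" and "b \<notin> \<real>"
    and "sq0 a = sq0 b" and "sq_K a = sq_K b"
  shows "{x :: split_quat. x * a = b * x} =
    {y - (y * a * sq_prime a - b * y * sq_prime a - sq_prime b * y * a + sq_prime b * b * y)
           /\<^sub>R (2 * (sq_Im_norm2 a + sq_Im_norm2 b)) | y :: split_quat. True}"
proof -
  define N where "N = 2 * (sq_Im_norm2 a + sq_Im_norm2 b)"
  have "N \<noteq> 0"
    using sq_Im_norm2_pos[OF assms(1)] sq_Im_norm2_pos[OF assms(2)] by (simp add: N_def)
  define T where "T = sylvester a b"
  define T' where "T' = sylvester (sq_prime a) (sq_prime b)"
  define S where "S = sylvester (sq_Im a) (- sq_Im b)"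
  define S' where "S' = sylvester (sq_prime (sq_Im a)) (- sq_prime (sq_Im b))"
  have numerator: "y * a * sq_prime a - b * y * sq_prime a - sq_prime b * y * a
      + sq_prime b * b * y = T' (T y)" for y
    by (simp add: T_def T'_def sylvester_def algebra_simps)
  have TS: "T (S z) = 0" for z
    using sylvester_sylvester_minus_eq_0[OF sq_Im_power2[of a]] assms(4)
    by (simp add: T_def S_def sylvester_sq_Im[OF assms(3)] sq_Im_power2)
  have Laplacian: "T' (T y) + S (S' y) = N *\<^sub>R y" for y
    using sylvester_Laplacian[of a b y]
    by (simp add: T_def T'_def S_def S'_def N_def sylvester_sq_Im[OF assms(3)]
        sylvester_sq_prime_sq_Im[OF assms(3)])
  have solution: "T (y - T' (T y) /\<^sub>R N) = 0" for y
  proof -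
    have "S (S' y) /\<^sub>R N = (N *\<^sub>R y - T' (T y)) /\<^sub>R N"
      by (simp flip: Laplacian)
    also have "\<dots> = y - T' (T y) /\<^sub>R N"
      using \<open>N \<noteq> 0\<close> by (simp add: scaleR_diff_right)
    finally have "T (y - T' (T y) /\<^sub>R N) = T (S (S' y) /\<^sub>R N)"
      by simp
    also have "\<dots> = T (S (S' y)) /\<^sub>R N"
      by (simp add: T_def sylvester_scaleR)
    finally show ?thesis
      by (simp add: TS)
  qed
  have fixed: "x = x - T' (T x) /\<^sub>R N" if "T x = 0" for x
    using that by (simp add: T'_def sylvester_def)
  have "{x. T x = 0} = {y - T' (T y) /\<^sub>R N | y. True}"
    using solution fixed by blast
  then show ?thesis
    by (simp add: numerator N_def T_def sylvester_eq_0_iff)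
qed

end
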